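(* Let $n\ge 2$, $k\ge3$, and let $V$ be a closed $k$-gon in $\mathbb{R}^n$. For each $i$ let $R_i$ denote the recutting at the $i$th vertex. 1) The monodromy is preserved by the recutting: for every $i$ and every $\lambda>0$, the monodromies of $V$ and $R_i(V)$ with length parameter $\lambda$, computed starting from any vertex other than the $i$th one, coincide. In particular, every function of $\lambda$ obtained as an invariant of the conjugacy class of $M_{V,\lambda}$ takes the same value on $V$ and on $R_i(V)$. 2) The discrete bicycle correspondence commutes with the recutting: if $W$ is a closed $k$-gon with $\mathcal{B}_\ell(V,W)$, then $\mathcal{B}_\ell(R_i(V),R_i(W))$ for every $i$.
   Context: A closed $k$-gon in $\mathbb{R}^n$ is a sequence of points $V_i$ with $V_{i+k}=V_i$ for all $i$. Recutting: $R_i(V)$ is the polygon obtained from $V$ by replacing $V_i$ (and $V_{i+mk}$, $m\in\mathbb{Z}$) by its reflection in the perpendicular bisector hyperplane of the segment $V_{i-1}V_{i+1}$, leaving the other vertices unchanged. It is considered when $V_{i-1}\neq V_{i+1}$. Discrete bicycle transport. Let $P,Q\in\mathbb{R}^n$, $\ell>0$, $\ell\ne|PQ|$, and let $X$ be a point with $|PX|=\ell$. Parallel translate $X$ along the vector $\overrightarrow{PQ}$ to $U=X+Q-P$ and reflect $U$ in the line $XQ$ (in the plane of $P,Q,X$) to obtain a point $Y$, the transport of $X$ along $PQ$; then $|QY|=\ell$ and $|XY|=|PQ|$. In terms of unit vectors $u=(X-P)/\ell$ and $v=(Y-Q)/\ell$ one has $v=\frac{2\,u\cdot\xi}{|\xi|^2}\,\xi-u$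 with $\xi=(Q-P)-\ell u$. This defines a map $m_{PQ,\ell}:S^{n-1}\to S^{n-1}$, $u\mapsto v$. The discrete bicycle monodromy of $V$ starting from vertex $V_j$ is $m_{V_{j+k-1}V_{j+k},\lambda}\circ\dots\circ m_{V_jV_{j+1},\lambda}$, a Möbius transformation of $S^{n-1}$; for $j=1$ it is denoted $M_{V,\lambda}$. Changing the starting vertex changes the monodromy by conjugation. Discrete bicycle correspondence: $\mathcal{B}_\ell(V,W)$ means that for all $i$, $|V_iW_i|=\ell$ and $W_{i+1}$ is the transport of $W_i$ along $V_iV_{i+1}$. The length parameters are taken different from all side lengths of the polygons, so that transports and monodromies are defined; in part 2 both recuttings are assumed to be defined. *)

theory Defs
  imports
    "HOL-Analysis.Analysis"
    "HOL-Number_Theory.Cong"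
    "HOL-Algebra.Bij"
    "HOL-Algebra.Generated_Groups"
begin

section \<open>Reflections\<close>

text \<open>Meaningful for a nonempty affine subspace \<open>S\<close>, where \<^const>\<open>closest_point\<close> is the orthogonal
  projection; it is only used for lines and for hyperplanes.\<close>

definition reflection_in :: "'a::euclidean_space set \<Rightarrow> 'a \<Rightarrow> 'a" where
  "reflection_in S x = 2 *\<^sub>R closest_point S x - x"

definition perp_bisector :: "'a::euclidean_space \<Rightarrow> 'a \<Rightarrow> 'a set" where
  "perp_bisector A B = {x. dist x A = dist x B}"

lemma closest_point_affine:
  fixes S :: "'a::euclidean_space set"
  assumes "affine S" "p \<in> S" and orth: "\<And>z. z \<in> S \<Longrightarrow> (x - p) \<bullet> (z - p) = 0"
  shows "closest_point S x = p"
proof -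
  have "dist x p \<le> dist x z" if "z \<in> S" for z
  proof -
    have "(norm (x - z))\<^sup>2 = (norm (x - p))\<^sup>2 + (norm (z - p))\<^sup>2"
      using orth[OF that]
      by (simp add: power2_norm_eq_inner inner_diff_left inner_diff_right inner_commute algebra_simps)
    then have "(norm (x - p))\<^sup>2 \<le> (norm (x - z))\<^sup>2" by simp
    from power2_le_imp_le[OF this norm_ge_zero] show ?thesis by (simp add: dist_norm)
  qed
  then show ?thesis
    using closest_point_unique[of S p x] assms by (auto simp: affine_imp_convex affine_closed)
qed

lemma perp_bisector_eq_hyperplane:
  "perp_bisector A B = {x. (B - A) \<bullet> x = (B - A) \<bullet> midpoint A B}"
proof -
  have "dist x A = dist x B \<longleftrightarrow> (B - A) \<bullet> x = (B - A) \<bullet> midpoint A B" for x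
  proof -
    have "dist x A = dist x B \<longleftrightarrow> (x - A) \<bullet> (x - A) = (x - B) \<bullet> (x - B)"
      by (simp add: dist_norm norm_eq)
    also have "\<dots> \<longleftrightarrow> (B - A) \<bullet> x = (B - A) \<bullet> midpoint A B"
      by (auto simp: midpoint_def inner_diff_left inner_diff_right inner_add_right inner_commute field_simps)
    finally show ?thesis .
  qed
  then show ?thesis by (auto simp: perp_bisector_def)
qed

lemma reflection_in_hyperplane:
  assumes "a \<noteq> 0"
  shows "reflection_in {x. a \<bullet> x = c} x = x - (2 * (x \<bullet> a - c) / (norm a)\<^sup>2) *\<^sub>R a"
proof -
  let ?t = "(x \<bullet> a - c) / (norm a)\<^sup>2"
  have nz: "a \<bullet> a \<noteq> 0" using assms by simp
  have "closest_point {x. a \<bullet> x = c} x = x - ?t *\<^sub>R a"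
  proof (rule closest_point_affine)
    show "affine {x. a \<bullet> x = c}" by (simp add: affine_hyperplane)
    show mem: "x - ?t *\<^sub>R a \<in> {x. a \<bullet> x = c}"
      using nz by (simp add: power2_norm_eq_inner inner_diff_right inner_commute)
    fix z assume "z \<in> {x. a \<bullet> x = c}"
    then have "a \<bullet> (z - (x - ?t *\<^sub>R a)) = 0"
      using mem unfolding inner_diff_right[of a z] mem_Collect_eq by simp
    then show "(x - (x - ?t *\<^sub>R a)) \<bullet> (z - (x - ?t *\<^sub>R a)) = 0"
      by simp
  qed
  then show ?thesis by (simp add: reflection_in_def scaleR_diff_right scaleR_2)
qed

lemma reflection_in_perp_bisector:
  assumes "A \<noteq> B"
  shows "reflection_in (perp_bisector A B) x =
    x - (2 * ((x - midpoint A B) \<bullet> (B - A)) / (norm (B - A))\<^sup>2) *\<^sub>R (B - A)"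
proof -
  have e: "x \<bullet> (B - A) - (B - A) \<bullet> midpoint A B = (x - midpoint A B) \<bullet> (B - A)"
    unfolding inner_diff_left[of x] by (subst (2) inner_commute) (rule refl)
  have "B - A \<noteq> 0" using assms by simp
  then show ?thesis
    unfolding perp_bisector_eq_hyperplane e[symmetric] by (rule reflection_in_hyperplane)
qed

lemma reflection_in_line:
  assumes "X \<noteq> Q"
  shows "reflection_in (affine hull {X, Q}) U =
    Q + (2 * ((U - Q) \<bullet> (X - Q)) / (norm (X - Q))\<^sup>2) *\<^sub>R (X - Q) - (U - Q)"
proof -
  let ?c = "((U - Q) \<bullet> (X - Q)) / (norm (X - Q))\<^sup>2"
  have nz: "(X - Q) \<bullet> (X - Q) \<noteq> 0" using assms by simp
  have hull: "affine hull {X, Q} = {Q + t *\<^sub>R (X - Q) | t. True}"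
    by (subst insert_commute) (auto simp: affine_hull_2_alt)
  have "closest_point (affine hull {X, Q}) U = Q + ?c *\<^sub>R (X - Q)"
  proof (rule closest_point_affine)
    show "Q + ?c *\<^sub>R (X - Q) \<in> affine hull {X, Q}"
      unfolding hull by blast
    have orth: "(U - (Q + ?c *\<^sub>R (X - Q))) \<bullet> (X - Q) = 0"
      using nz by (simp add: power2_norm_eq_inner inner_diff_left[of "U - Q"] flip: diff_diff_eq)
    fix z assume "z \<in> affine hull {X, Q}"
    then obtain t where "z = Q + t *\<^sub>R (X - Q)" unfolding hull by blast
    then have z: "z - (Q + ?c *\<^sub>R (X - Q)) = (t - ?c) *\<^sub>R (X - Q)"
      by (simp add: scaleR_diff_left)
    show "(U - (Q + ?c *\<^sub>R (X - Q))) \<bullet> (z - (Q + ?c *\<^sub>R (X - Q))) = 0"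
      unfolding z inner_scaleR_right orth by simp
  qed simp
  then show ?thesis by (simp add: reflection_in_def scaleR_add_right scaleR_2)
qed


section \<open>Closed polygons and recutting\<close>

definition closed_polygon :: "nat \<Rightarrow> (int \<Rightarrow> 'a) \<Rightarrow> bool" where
  "closed_polygon k V \<longleftrightarrow> (\<forall>i. V (i + int k) = V i)"

definition recut :: "nat \<Rightarrow> int \<Rightarrow> (int \<Rightarrow> 'a::euclidean_space) \<Rightarrow> int \<Rightarrow> 'a" where
  "recut k i V = (\<lambda>j. if [j = i] (mod int k)
     then reflection_in (perp_bisector (V (j - 1)) (V (j + 1))) (V j) else V j)"


section \<open>Discrete bicycle transport, monodromy and correspondence\<close>

definition transport :: "'a::euclidean_space \<Rightarrow> 'a \<Rightarrow> 'a \<Rightarrow> 'a" where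
  "transport P Q X = reflection_in (affine hull {X, Q}) (X + Q - P)"

definition transport_dir :: "'a::euclidean_space \<Rightarrow> 'a \<Rightarrow> real \<Rightarrow> 'a \<Rightarrow> 'a" where
  "transport_dir P Q l u = (transport P Q (P + l *\<^sub>R u) - Q) /\<^sub>R l"

lemma transport_dir_formula:
  assumes "l > 0" "norm u = 1" "l \<noteq> dist P Q"
  defines "\<xi> \<equiv> (Q - P) - l *\<^sub>R u"
  shows "transport_dir P Q l u = (2 * (u \<bullet> \<xi>) / (norm \<xi>)\<^sup>2) *\<^sub>R \<xi> - u"
proof -
  have ne: "P + l *\<^sub>R u \<noteq> Q"
  proof
    assume "P + l *\<^sub>R u = Q"
    then have "dist P Q = norm (l *\<^sub>R u)" by (metis add_diff_cancel_left' dist_commute dist_norm)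
    then show False using assms by simp
  qed
  have X: "P + l *\<^sub>R u - Q = - \<xi>" by (simp add: \<xi>_def)
  have U: "P + l *\<^sub>R u + Q - P - Q = l *\<^sub>R u" by simp
  have "transport P Q (P + l *\<^sub>R u) - Q = l *\<^sub>R ((2 * (u \<bullet> \<xi>) / (norm \<xi>)\<^sup>2) *\<^sub>R \<xi> - u)"
    unfolding transport_def reflection_in_line[OF ne] X U
    by (simp add: scaleR_diff_right)
  then show ?thesis using \<open>l > 0\<close> by (simp add: transport_dir_def)
qed

lemma norm_transport_dir:
  assumes "l > 0" "norm u = 1" "l \<noteq> dist P Q"
  shows "norm (transport_dir P Q l u) = 1"
proof -
  define \<xi> where "\<xi> = (Q - P) - l *\<^sub>R u"
  have "\<xi> \<noteq> 0"
  proof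
    assume "\<xi> = 0"
    then have "norm (Q - P) = l" using assms by (simp add: \<xi>_def)
    then show False using assms by (simp add: dist_norm norm_minus_commute)
  qed
  then have nz: "\<xi> \<bullet> \<xi> \<noteq> 0" by simp
  have "u \<bullet> u = 1" using assms by (simp add: norm_eq_1)
  then have "transport_dir P Q l u \<bullet> transport_dir P Q l u = 1"
    using nz unfolding transport_dir_formula[OF assms, folded \<xi>_def]
    by (simp add: power2_norm_eq_inner inner_diff_left inner_diff_right inner_commute field_simps)
  then show ?thesis by (simp add: norm_eq_1)
qed

fun transport_along :: "(int \<Rightarrow> 'a::euclidean_space) \<Rightarrow> real \<Rightarrow> int \<Rightarrow> nat \<Rightarrow> 'a \<Rightarrow> 'a" where
  "transport_along V l j 0 u = u"
| "transport_along V l j (Suc m) u =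
     transport_dir (V (j + int m)) (V (j + int m + 1)) l (transport_along V l j m u)"

text \<open>A self-map of the unit sphere, represented by a function that is extensional on it, so that
  equality of monodromies is equality of functions.\<close>

definition monodromy :: "nat \<Rightarrow> (int \<Rightarrow> 'a::euclidean_space) \<Rightarrow> real \<Rightarrow> int \<Rightarrow> 'a \<Rightarrow> 'a" where
  "monodromy k V l j = restrict (transport_along V l j k) (sphere 0 1)"

definition bicycle_corr :: "real \<Rightarrow> (int \<Rightarrow> 'a::euclidean_space) \<Rightarrow> (int \<Rightarrow> 'a) \<Rightarrow> bool" where
  "bicycle_corr l V W \<longleftrightarrow>
     (\<forall>i. dist (V i) (W i) = l \<and> W (i + 1) = transport (V i) (V (i + 1)) (W i))"


section \<open>The Moebius group of the unit sphere\<close>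

definition sphere_inversion :: "'a::euclidean_space \<Rightarrow> 'a \<Rightarrow> 'a" where
  "sphere_inversion b x = b + (((norm b)\<^sup>2 - 1) / (norm (x - b))\<^sup>2) *\<^sub>R (x - b)"

text \<open>The inversions of the unit sphere in its codimension-one subspheres: a great subsphere gives
  the reflection in a linear hyperplane, and any other one gives the inversion in the sphere
  orthogonal to the unit sphere, whose centre \<open>b\<close> lies outside and whose squared radius is
  \<open>(norm b)\<^sup>2 - 1\<close>.\<close>

definition moebius_generators :: "('a::euclidean_space \<Rightarrow> 'a) set" where
  "moebius_generators =
     {restrict (reflection_in {x. a \<bullet> x = 0}) (sphere 0 1) | a. a \<noteq> 0} \<union>
     {restrict (sphere_inversion b) (sphere 0 1) | b. norm b > 1}"

definition moebius_group :: "('a::euclidean_space \<Rightarrow> 'a) monoid" where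
  "moebius_group = subgroup_generated (BijGroup (sphere 0 1)) moebius_generators"

text \<open>\<^const>\<open>subgroup_generated\<close> discards generators outside the carrier; here there are none.\<close>

lemma moebius_generators_subset:
  "moebius_generators \<subseteq> carrier (BijGroup (sphere 0 1 :: 'a::euclidean_space set))"
proof
  let ?S = "sphere 0 1 :: 'a set"
  have invol: "restrict f ?S \<in> carrier (BijGroup ?S)"
    if "\<And>x. x \<bullet> x = 1 \<Longrightarrow> f x \<bullet> f x = 1 \<and> f (f x) = x" for f
  proof -
    have "bij_betw f ?S ?S"
      using that by (intro bij_betw_byWitness[where f' = f]) (auto simp: norm_eq_1)
    then have "bij_betw (restrict f ?S) ?S ?S"
      by (rule bij_betw_restrict_eq[THEN iffD2])
    then show ?thesis
      by (simp add: BijGroup_def Bij_def)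
  qed
  fix g :: "'a \<Rightarrow> 'a" assume "g \<in> moebius_generators"
  then consider (refl) a where "a \<noteq> 0" "g = restrict (reflection_in {x. a \<bullet> x = 0}) ?S"
    | (inversion) b where "norm b > 1" "g = restrict (sphere_inversion b) ?S"
    by (auto simp: moebius_generators_def)
  then show "g \<in> carrier (BijGroup ?S)"
  proof cases
    case refl
    let ?f = "reflection_in {x. a \<bullet> x = 0}"
    show ?thesis
      unfolding refl(2)
    proof (rule invol)
      fix x :: 'a assume x: "x \<bullet> x = 1"
      define c where "c = 2 * (x \<bullet> a) / (norm a)\<^sup>2"
      have c: "c * (a \<bullet> a) = 2 * (x \<bullet> a)"
        using refl(1) by (simp add: c_def power2_norm_eq_inner)
      have f: "?f x = x - c *\<^sub>R a"
        using refl(1) by (simp add: c_def reflection_in_hyperplane)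
      have "?f x \<bullet> ?f x = 1 - 2 * c * (x \<bullet> a) + c * (c * (a \<bullet> a))"
        unfolding f inner_diff_left inner_diff_right x by (simp add: inner_commute)
      then have "?f x \<bullet> ?f x = 1" by (simp add: c)
      moreover have "?f x \<bullet> a = - (x \<bullet> a)"
        by (simp add: f inner_diff_left c)
      then have "?f (?f x) = ?f x + c *\<^sub>R a"
        using refl(1) by (subst reflection_in_hyperplane) (simp_all add: c_def)
      then have "?f (?f x) = x" by (simp add: f)
      ultimately show "?f x \<bullet> ?f x = 1 \<and> ?f (?f x) = x" by blast
    qed
  next
    case inversion
    show ?thesis
      unfolding inversion(2)
    proof (rule invol)
      fix x :: 'a assume x: "x \<bullet> x = 1"
      let ?f = "sphere_inversion b"
      define d where "d = x - b"
      define r where "r = b \<bullet> b - 1"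
      have r: "r > 0" 
        using inversion(1) power_strict_mono[of 1 "norm b" 2] by (simp add: r_def power2_norm_eq_inner)
      have "d \<noteq> 0" using x r by (auto simp: d_def r_def)
      then have dd: "d \<bullet> d > 0" by simp
      have bd: "2 * (b \<bullet> d) = - r - d \<bullet> d"
        using x by (simp add: d_def r_def inner_diff_left inner_diff_right inner_commute)
      have f: "?f x = b + (r / (d \<bullet> d)) *\<^sub>R d"
        by (simp add: sphere_inversion_def d_def r_def power2_norm_eq_inner)
      define c where "c = r / (d \<bullet> d)"
      have c: "c * (d \<bullet> d) = r" "c > 0" using dd r by (simp_all add: c_def)
      have "?f x \<bullet> ?f x = b \<bullet> b + c * (2 * (b \<bullet> d)) + c * (c * (d \<bullet> d))"
        unfolding f c_def[symmetric] inner_add_left inner_add_right by (simp add: inner_commute)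
      also have "\<dots> = b \<bullet> b - c * (d \<bullet> d)"
        unfolding bd by (simp add: algebra_simps c(1)[symmetric])
      finally have 1: "?f x \<bullet> ?f x = 1" unfolding c(1) r_def by simp
      have "?f (?f x) = b + (r / (c * (c * (d \<bullet> d)))) *\<^sub>R (c *\<^sub>R d)"
        unfolding f unfolding c_def[symmetric] sphere_inversion_def power2_norm_eq_inner
        by (simp add: r_def)
      also have "\<dots> = b + d"
        using c r by simp
      finally show "?f x \<bullet> ?f x = 1 \<and> ?f (?f x) = x" using 1 by (simp add: d_def)
    qed
  qed
qed

definition conjugacy_invariant :: "(('a::euclidean_space \<Rightarrow> 'a) \<Rightarrow> 'b) \<Rightarrow> bool" where
  "conjugacy_invariant F \<longleftrightarrow>
     (\<forall>f \<in> carrier moebius_group. \<forall>g \<in> carrier moebius_group.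
        F (g \<otimes>\<^bsub>moebius_group\<^esub> f \<otimes>\<^bsub>moebius_group\<^esub> inv\<^bsub>moebius_group\<^esub> g) = F f)"

end

theory Submission
  imports Defs
begin

text \<open>
  In homogeneous coordinates on the unit sphere, the transport along an edge vector \<open>a\<close> is given
  by a matrix whose entries are polynomials in \<open>a\<close> and the length parameter (\<open>transport_dir_eq_lift\<close>).
  Recutting replaces two consecutive edges \<open>a\<close>, \<open>b\<close> by edges with the same sum, in the same plane, with
  exchanged lengths, and the product of the two matrices is the same before and after (\<open>lift_recut\<close>).
  Hence the composition of the two transports around a recut vertex does not change, and neither does
  the transport along any path whose end points are not recut (\<open>transport_along_recut\<close>). If the
  monodromy is based at the recut vertex, the base point is moved to a neighbouring vertex, which conjugates the
  monodromy by a transport; transports lie in the Moebius group (\<open>transport_dir_moebius\<close>), so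
  conjugacy invariants are preserved as well.

  For the correspondence, let \<open>W\<close> be obtained from \<open>V\<close> by transport. The vertices of \<open>W\<close> next to a
  recut vertex are linked by transport along the recut path of \<open>V\<close> too, because of the first part; it
  remains to identify the intermediate point with the recut vertex of \<open>W\<close>
  (\<open>transport_of_recut_vertex\<close>). Its two edges have the right lengths since transport produces isosceles
  trapezoids, and the right sum. This leaves it free to rotate about the diagonal. The
  missing datum is the bivector of the two edges, and this depends only on quantities which recutting of \<open>V\<close> preserves
  (\<open>wedge_transported_edges\<close>).
\<close>

section \<open>Transport as a linear map in homogeneous coordinates\<close>

text \<open>A transport along an edge vector \<open>a\<close> is a Moebius map, so it becomes linear on the light
  cone: \<open>(s, u)\<close> stands for the point \<open>u / s\<close> of the sphere, and \<open>(lift_scale, lift_vec)\<close> is the image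
  of \<open>(s, u)\<close>. The formula comes from multiplying \<open>v = (2 (u \<bullet> \<xi>) / (norm \<xi>)\<^sup>2) \<xi> - u\<close>, with
  \<open>\<xi> = a - l u\<close>, by \<open>(norm \<xi>)\<^sup>2\<close>: since \<open>norm u = 1\<close>, all terms of degree above one in \<open>u\<close>
  disappear.\<close>

definition lift_scale :: "real \<Rightarrow> 'a::real_inner \<Rightarrow> real \<Rightarrow> 'a \<Rightarrow> real" where
  "lift_scale l a s u = (a \<bullet> a + l\<^sup>2) * s - 2 * l * (a \<bullet> u)"

definition lift_vec :: "real \<Rightarrow> 'a::real_inner \<Rightarrow> real \<Rightarrow> 'a \<Rightarrow> 'a" where
  "lift_vec l a s u = (2 * (a \<bullet> u) - 2 * l * s) *\<^sub>R a + (l\<^sup>2 - a \<bullet> a) *\<^sub>R u"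

lemma lift_scale_homogeneous: "lift_scale l a (t * s) (t *\<^sub>R u) = t * lift_scale l a s u"
  by (simp add: lift_scale_def algebra_simps)

lemma lift_vec_homogeneous: "lift_vec l a (t * s) (t *\<^sub>R u) = t *\<^sub>R lift_vec l a s u"
  by (simp add: lift_vec_def algebra_simps)

text \<open>The scale is the squared length of the axis of reflection, which vanishes only if \<open>a = l u\<close>;
  this is where the length parameter must differ from the side length.\<close>

lemma transport_axis:
  fixes a :: "'a::real_inner"
  assumes "norm u = 1" "l > 0" "norm a \<noteq> l"
  shows "a - l *\<^sub>R u \<noteq> 0" "(a - l *\<^sub>R u) \<bullet> (a - l *\<^sub>R u) = lift_scale l a 1 u"
    "lift_scale l a 1 u > 0"
proof -
  have uu: "u \<bullet> u = 1" using assms by (simp add: norm_eq_1)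
  show nz: "a - l *\<^sub>R u \<noteq> 0" using assms by auto
  show e: "(a - l *\<^sub>R u) \<bullet> (a - l *\<^sub>R u) = lift_scale l a 1 u"
    by (simp add: lift_scale_def inner_diff_left inner_diff_right inner_commute uu power2_eq_square)
  show "lift_scale l a 1 u > 0" unfolding e[symmetric] using nz by simp
qed

lemma transport_dir_eq_lift:
  assumes "l > 0" "norm u = 1" "l \<noteq> dist P Q"
  shows "transport_dir P Q l u = lift_vec l (Q - P) 1 u /\<^sub>R lift_scale l (Q - P) 1 u"
proof -
  define a where "a = Q - P"
  define x where "x = a - l *\<^sub>R u"
  have uu: "u \<bullet> u = 1" using assms by (simp add: norm_eq_1)
  have na: "norm a \<noteq> l" using assms by (simp add: a_def dist_norm norm_minus_commute)
  note ax = transport_axis[OF assms(2,1) na, folded x_def]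
  have ux: "u \<bullet> x = a \<bullet> u - l"
    by (simp add: x_def inner_diff_right uu inner_commute)
  have "l\<^sup>2 - a \<bullet> a = - (2 * (u \<bullet> x) * l) - lift_scale l a 1 u"
    unfolding ux lift_scale_def by (simp add: algebra_simps power2_eq_square)
  then have "lift_vec l a 1 u = (2 * (u \<bullet> x)) *\<^sub>R x - lift_scale l a 1 u *\<^sub>R u"
    unfolding lift_vec_def ux by (simp add: x_def scaleR_diff_left scaleR_diff_right)
  then have "lift_vec l a 1 u /\<^sub>R lift_scale l a 1 u = (2 * (u \<bullet> x) / (norm x)\<^sup>2) *\<^sub>R x - u"
    using ax(3) by (simp add: power2_norm_eq_inner ax(2) scaleR_diff_right divide_inverse_commute)
  then show ?thesis
    using transport_dir_formula[OF assms] unfolding a_def x_def by simp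
qed

text \<open>By homogeneity the two divisions can be postponed to the end, so that a composition of
  transports is a single quotient of polynomials.\<close>

lemma transport_dir_twice_eq_lift:
  assumes "l > 0" "norm u = 1" "l \<noteq> dist P Q" "l \<noteq> dist Q R"
  defines "a \<equiv> Q - P" and "b \<equiv> R - Q"
  shows "transport_dir Q R l (transport_dir P Q l u) =
    lift_vec l b (lift_scale l a 1 u) (lift_vec l a 1 u) /\<^sub>R
    lift_scale l b (lift_scale l a 1 u) (lift_vec l a 1 u)"
proof -
  define s where "s = lift_scale l a 1 u"
  define w where "w = lift_vec l a 1 u"
  have na: "norm a \<noteq> l" using assms by (simp add: a_def dist_norm norm_minus_commute)
  have s: "s > 0" using transport_axis(3)[OF assms(2,1) na] by (simp add: s_def)
  have v: "transport_dir P Q l u = w /\<^sub>R s"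
    using transport_dir_eq_lift[OF assms(1-3)] by (simp add: a_def s_def w_def)
  have "lift_vec l b 1 (w /\<^sub>R s) = lift_vec l b s w /\<^sub>R s"
    "lift_scale l b 1 (w /\<^sub>R s) = inverse s * lift_scale l b s w"
    using lift_vec_homogeneous[of l b "inverse s" s w]
      lift_scale_homogeneous[of l b "inverse s" s w] s by simp_all
  then show ?thesis
    using s transport_dir_eq_lift[OF assms(1) norm_transport_dir[OF assms(1-3)] assms(4)]
    unfolding v b_def[symmetric] s_def[symmetric] w_def[symmetric] by (simp add: field_simps)
qed

text \<open>The reflection in the perpendicular bisector of a segment moves a point parallel to the
  segment; for the middle vertex of the path with edges \<open>a\<close>, \<open>b\<close> this is the displacement with the
  opposite sign, so that the recut edges are \<open>a - recut_shift a b\<close> and \<open>b + recut_shift a b\<close>.\<close>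

definition recut_shift :: "'a::real_inner \<Rightarrow> 'a \<Rightarrow> 'a" where
  "recut_shift a b = ((a \<bullet> a - b \<bullet> b) / ((a + b) \<bullet> (a + b))) *\<^sub>R (a + b)"

text \<open>The core of the invariance of the monodromy. The product of the two matrices is determined
  by \<open>a + b\<close>, \<open>a \<bullet> b\<close>, the pair of lengths up to order, and the vector \<open>((a + b) \<bullet> (a + b)) a - (a \<bullet> a) (a + b)\<close>;
  recutting preserves each of them, since it moves \<open>a\<close> along \<open>a + b\<close> and exchanges the two lengths.\<close>

lemma lift_recut:
  fixes a b :: "'a::real_inner"
  assumes "a + b \<noteq> 0"
  defines "a' \<equiv> a - recut_shift a b" and "b' \<equiv> b + recut_shift a b"
  shows "a' \<bullet> a' = b \<bullet> b" "b' \<bullet> b' = a \<bullet> a"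
    "lift_scale l b' (lift_scale l a' s u) (lift_vec l a' s u) =
     lift_scale l b (lift_scale l a s u) (lift_vec l a s u)"
    "lift_vec l b' (lift_scale l a' s u) (lift_vec l a' s u) =
     lift_vec l b (lift_scale l a s u) (lift_vec l a s u)"
proof -
  define \<kappa> where "\<kappa> = (a \<bullet> a - b \<bullet> b) / ((a + b) \<bullet> (a + b))"
  define A B C p q where abc: "A = a \<bullet> a" "B = b \<bullet> b" "C = a \<bullet> b" "p = a \<bullet> u" "q = b \<bullet> u"
  \<comment> \<open>The defining relation of \<open>\<kappa>\<close> without denominators: the identities below are polynomial
    consequences of it.\<close>
  have "\<kappa> * ((a + b) \<bullet> (a + b)) = a \<bullet> a - b \<bullet> b" using assms(1) by (simp add: \<kappa>_def)
  then have k: "\<kappa> * (A + 2 * C + B) = A - B"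
    by (simp add: abc inner_add_left inner_add_right inner_commute algebra_simps)
  have a': "a' = (1 - \<kappa>) *\<^sub>R a - \<kappa> *\<^sub>R b" and b': "b' = \<kappa> *\<^sub>R a + (1 + \<kappa>) *\<^sub>R b"
    unfolding a'_def b'_def recut_shift_def \<kappa>_def[symmetric]
    by (simp_all add: algebra_simps)
  have ba: "b \<bullet> a = C" by (simp add: abc inner_commute)
  note inn = inner_add_left inner_add_right inner_diff_left inner_diff_right
    abc[symmetric] ba
  have "a' \<bullet> a' = (1 - \<kappa>) * ((1 - \<kappa>) * A - \<kappa> * C) - \<kappa> * ((1 - \<kappa>) * C - \<kappa> * B)"
    by (simp add: a' inn)
  also have "\<dots> = B" using k by algebra
  finally show aa: "a' \<bullet> a' = b \<bullet> b" by (simp add: abc)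
  have "b' \<bullet> b' = \<kappa> * (\<kappa> * A + (1 + \<kappa>) * C) + (1 + \<kappa>) * (\<kappa> * C + (1 + \<kappa>) * B)"
    by (simp add: b' inn)
  also have "\<dots> = A" using k by algebra
  finally show bb: "b' \<bullet> b' = a \<bullet> a" by (simp add: abc)
  have "a' \<bullet> b' = (1 - \<kappa>) * (\<kappa> * A + (1 + \<kappa>) * C) - \<kappa> * (\<kappa> * C + (1 + \<kappa>) * B)"
    by (simp add: a' b' inn algebra_simps)
  also have "\<dots> = C" using k by algebra
  finally have ab: "a' \<bullet> b' = a \<bullet> b" by (simp add: abc)
  define p' q' where pq: "p' = a' \<bullet> u" "q' = b' \<bullet> u"
  have p': "p' = (1 - \<kappa>) * p - \<kappa> * q" and q': "q' = \<kappa> * p + (1 + \<kappa>) * q"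
    by (simp_all add: pq a' b' inn)
  have "(B + l\<^sup>2) * ((A + l\<^sup>2) * s - 2 * l * p) - 2 * l * ((2 * p - 2 * l * s) * C + (l\<^sup>2 - A) * q)
    = (A + l\<^sup>2) * ((B + l\<^sup>2) * s - 2 * l * p') - 2 * l * ((2 * p' - 2 * l * s) * C + (l\<^sup>2 - B) * q')"
    using k unfolding p' q' by algebra
  then show "lift_scale l b' (lift_scale l a' s u) (lift_vec l a' s u) =
     lift_scale l b (lift_scale l a s u) (lift_vec l a s u)"
    unfolding lift_scale_def lift_vec_def aa bb inner_add_right inner_scaleR_right
      inner_commute[of b' a'] ab pq[symmetric] abc[symmetric] ba by simp
  \<comment> \<open>The coefficients of \<open>b\<close> and of \<open>a\<close> in the vector part of the product.\<close>
  define e where "e = (\<lambda>A p q. 2 * ((2 * p - 2 * l * s) * C + (l\<^sup>2 - A) * q) - 2 * l * ((A + l\<^sup>2) * s - 2 * l * p))"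
  define f where "f = (\<lambda>B p. (l\<^sup>2 - B) * (2 * p - 2 * l * s))"
  have 1: "e B p' q' * \<kappa> + f A p' * (1 - \<kappa>) = f B p"
    using k unfolding p' q' e_def f_def by algebra
  have 2: "e B p' q' * (1 + \<kappa>) - f A p' * \<kappa> = e A p q"
    using k unfolding p' q' e_def f_def by algebra
  have "lift_vec l b' (lift_scale l a' s u) (lift_vec l a' s u)
      = e B p' q' *\<^sub>R b' + f A p' *\<^sub>R a' + ((l\<^sup>2 - A) * (l\<^sup>2 - B)) *\<^sub>R u"
    unfolding lift_scale_def lift_vec_def aa bb inner_add_right inner_scaleR_right
      inner_commute[of b' a'] ab pq[symmetric] abc[symmetric] ba
    by (simp add: e_def f_def scaleR_add_right)
  also have "e B p' q' *\<^sub>R b' + f A p' *\<^sub>R a'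
      = (e B p' q' * \<kappa> + f A p' * (1 - \<kappa>)) *\<^sub>R a + (e B p' q' * (1 + \<kappa>) - f A p' * \<kappa>) *\<^sub>R b"
    unfolding a' b' by (simp only: scaleR_add_left scaleR_add_right scaleR_diff_left scaleR_diff_right scaleR_scaleR add.assoc diff_conv_add_uminus)
       (simp add: algebra_simps)
  also have "\<dots> = f B p *\<^sub>R a + e A p q *\<^sub>R b" unfolding 1 2 ..
  also have "f B p *\<^sub>R a + e A p q *\<^sub>R b + ((l\<^sup>2 - A) * (l\<^sup>2 - B)) *\<^sub>R u = 
      lift_vec l b (lift_scale l a s u) (lift_vec l a s u)"
    unfolding lift_scale_def lift_vec_def inner_add_right inner_scaleR_right abc[symmetric] ba
    by (simp add: e_def f_def scaleR_add_right mult.commute)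
  finally show "lift_vec l b' (lift_scale l a' s u) (lift_vec l a' s u) =
     lift_vec l b (lift_scale l a s u) (lift_vec l a s u)" .
qed

section \<open>Transports are Moebius transformations of the sphere\<close>

abbreviation unit_sphere :: "'a::euclidean_space set" where "unit_sphere \<equiv> sphere 0 1"

lemma carrier_moebius_group:
  "carrier moebius_group = generate (BijGroup unit_sphere) (moebius_generators :: ('a::euclidean_space \<Rightarrow> 'a) set)"
  unfolding moebius_group_def carrier_subgroup_generated
  by (simp only: Int_absorb1[OF moebius_generators_subset])

lemma group_moebius_group: "group (moebius_group :: ('a::euclidean_space \<Rightarrow> 'a) monoid)"
  unfolding moebius_group_def by (simp add: group.group_subgroup_generated group_BijGroup)

lemma moebius_maps_sphere:
  assumes "f \<in> carrier moebius_group" "x \<in> unit_sphere"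
  shows "f x \<in> unit_sphere"
proof -
  have "f \<in> carrier (BijGroup unit_sphere)"
    using assms(1) group.carrier_subgroup_generated_subset[OF group_BijGroup]
    by (auto simp: moebius_group_def)
  then show ?thesis using assms(2) by (auto simp: BijGroup_def Bij_def bij_betw_def)
qed

lemma moebius_mult:
  assumes "g \<in> carrier moebius_group" "f \<in> carrier moebius_group"
  shows "g \<otimes>\<^bsub>moebius_group\<^esub> f = restrict (\<lambda>x. g (f x)) unit_sphere"
proof -
  have "g \<in> Bij unit_sphere" "f \<in> Bij unit_sphere"
    using assms group.carrier_subgroup_generated_subset[OF group_BijGroup]
    by (auto simp: moebius_group_def BijGroup_def)
  then show ?thesis
    by (simp add: moebius_group_def BijGroup_def compose_def)
qed

text \<open>Membership is stated for functions restricted to the sphere, so that maps of the whole space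
  can be composed without regard to their values outside the sphere.\<close>

lemma moebius_comp:
  assumes "restrict g unit_sphere \<in> carrier moebius_group"
    and "restrict f unit_sphere \<in> carrier moebius_group"
  shows "restrict (\<lambda>x. g (f x)) unit_sphere \<in> carrier moebius_group"
proof -
  interpret group moebius_group by (rule group_moebius_group)
  have "restrict g unit_sphere \<otimes>\<^bsub>moebius_group\<^esub> restrict f unit_sphere = restrict (\<lambda>x. g (f x)) unit_sphere"
    unfolding moebius_mult[OF assms]
    using moebius_maps_sphere[OF assms(2)] by (intro restrict_ext) auto
  then show ?thesis using m_closed[OF assms] by simp
qed

lemma moebius_id: "restrict (\<lambda>x. x) unit_sphere \<in> carrier moebius_group"
proof -
  interpret group moebius_group by (rule group_moebius_group)
  have "\<one>\<^bsub>moebius_group\<^esub> = restrict (\<lambda>x::'a. x) unit_sphere"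
    by (simp add: moebius_group_def BijGroup_def)
  then show ?thesis by (metis one_closed)
qed

lemma moebius_reflection:
  assumes "a \<noteq> 0"
  shows "restrict (\<lambda>x. x - (2 * (x \<bullet> a) / (a \<bullet> a)) *\<^sub>R a) unit_sphere \<in> carrier moebius_group"
proof -
  have "reflection_in {x. a \<bullet> x = 0} = (\<lambda>x. x - (2 * (x \<bullet> a) / (a \<bullet> a)) *\<^sub>R a)"
    using reflection_in_hyperplane[OF assms, of 0] by (auto simp: power2_norm_eq_inner)
  then show ?thesis
    unfolding carrier_moebius_group using assms
    by (intro generate.incl) (auto simp: moebius_generators_def intro!: exI[of _ a])
qed

lemma moebius_inversion:
  assumes "norm b > 1"
  shows "restrict (sphere_inversion b) unit_sphere \<in> carrier moebius_group"
  unfolding carrier_moebius_group using assms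
  by (intro generate.incl) (auto simp: moebius_generators_def)

text \<open>The antipodal map is the product of the reflections in the coordinate hyperplanes.\<close>

lemma moebius_antipodal: "restrict uminus unit_sphere \<in> carrier (moebius_group :: ('a::euclidean_space \<Rightarrow> 'a) monoid)"
proof -
  define f where "f = (\<lambda>B (x::'a). x - (\<Sum>b\<in>B. (2 * (x \<bullet> b)) *\<^sub>R b))"
  have "restrict (f B) unit_sphere \<in> carrier moebius_group" if "finite B" "B \<subseteq> Basis" for B
    using that
  proof (induction B rule: finite_induct)
    case empty
    have "f {} = (\<lambda>x. x)" by (simp add: f_def)
    then show ?case using moebius_id by metis
  next
    case (insert c B)
    have c: "c \<in> Basis" "c \<noteq> 0" and cc: "c \<bullet> c = 1"
      using insert.prems by (auto simp: inner_same_Basis)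
    have "b \<bullet> c = 0" if "b \<in> B" for b
      using that insert.hyps insert.prems by (intro inner_not_same_Basis) auto
    then have "f B x \<bullet> c = x \<bullet> c" for x
      by (simp add: f_def inner_diff_left inner_sum_left)
    then have "f (insert c B) = (\<lambda>x. f B x - (2 * (f B x \<bullet> c) / (c \<bullet> c)) *\<^sub>R c)"
      using insert.hyps by (auto simp: f_def cc)
    moreover have "restrict (f B) unit_sphere \<in> carrier moebius_group"
      by (rule insert.IH) (use insert.prems in simp)
    ultimately show ?case
      by (simp only: moebius_comp[OF moebius_reflection[OF c(2)]])
  qed
  moreover have "f Basis x = - x" for x
    using euclidean_representation[of x]
    by (simp add: f_def flip: scaleR_scaleR scaleR_sum_right) (simp add: scaleR_2)
  then have "f Basis = uminus" by auto
  ultimately show ?thesis by (metis finite_Basis subset_refl)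
qed

text \<open>Conjugation by a single transport links the monodromies at neighbouring vertices, so
  transports have to be written through the generators. Put \<open>e = a / l\<close>. The axis direction
  \<open>e - u\<close> shows that \<open>- v\<close> is the second intersection of the sphere with the line through \<open>u\<close> and \<open>e\<close>.
  If \<open>e\<close> lies outside, this second intersection is the inversion with centre \<open>e\<close>. If \<open>e \<noteq> 0\<close> lies inside,
  the transport is a hyperbolic translation along \<open>e\<close>: the product of the inversion centred at the pole
  \<open>e / (norm e)\<^sup>2\<close> and of the reflection in the linear hyperplane orthogonal to \<open>e\<close>.\<close>

lemma transport_dir_moebius:
  fixes P Q :: "'a::euclidean_space"
  assumes l: "l > 0" "l \<noteq> dist P Q"
  shows "restrict (transport_dir P Q l) unit_sphere \<in> carrier moebius_group"
proof -
  define a where "a = Q - P"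
  define p where "p u = a \<bullet> u" for u
  define N where "N u = lift_scale l a 1 u" for u
  have na: "norm a \<noteq> l" using l by (simp add: a_def dist_norm norm_minus_commute)
  have t: "transport_dir P Q l u = lift_vec l a 1 u /\<^sub>R N u" if "u \<in> unit_sphere" for u
    using transport_dir_eq_lift[OF l(1) _ l(2), of u] that by (simp add: a_def N_def)
  have Npos: "N u > 0" if "u \<in> unit_sphere" for u
    using transport_axis(3)[OF _ l(1) na] that by (simp add: N_def)
  have lift: "lift_vec l a 1 u = (2 * p u - 2 * l) *\<^sub>R a + (l\<^sup>2 - a \<bullet> a) *\<^sub>R u" for u
    by (simp add: lift_vec_def p_def)
  have N: "N u = a \<bullet> a + l\<^sup>2 - 2 * l * p u" for u
    by (simp add: N_def lift_scale_def p_def)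
  consider "a = 0" | "norm a > l" | "a \<noteq> 0" "norm a < l" using na by linarith
  then show ?thesis
  proof cases
    case 1
    then have "restrict (transport_dir P Q l) unit_sphere = restrict (\<lambda>x. x) unit_sphere"
      using l by (intro restrict_ext) (simp add: t lift_vec_def N_def lift_scale_def)
    then show ?thesis using moebius_id by simp
  next
    case 2
    define e where "e = a /\<^sub>R l"
    have "norm e > 1" using 2 l by (simp add: e_def field_simps)
    have "transport_dir P Q l u = - sphere_inversion e u" if u: "u \<in> unit_sphere" for u
    proof -
      have uu: "u \<bullet> u = 1" using u by (simp add: norm_eq_1)
      have e2: "(norm e)\<^sup>2 = a \<bullet> a / l\<^sup>2"
        unfolding power2_norm_eq_inner by (simp add: e_def power2_eq_square field_simps)
      have ue: "(norm (u - e))\<^sup>2 = N u / l\<^sup>2"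
        using l uu unfolding power2_norm_eq_inner N e_def p_def
        by (simp add: inner_diff_left inner_diff_right inner_commute field_simps power2_eq_square)
      have c: "((norm e)\<^sup>2 - 1) / (norm (u - e))\<^sup>2 = (a \<bullet> a - l\<^sup>2) / N u"
        unfolding e2 ue using l Npos[OF u] by (simp add: field_simps)
      have "N u - (a \<bullet> a - l\<^sup>2) = - (2 * p u - 2 * l) * l"
        by (simp add: N algebra_simps power2_eq_square)
      moreover have "1 / l - (a \<bullet> a - l\<^sup>2) / N u / l = (N u - (a \<bullet> a - l\<^sup>2)) / (N u * l)"
        using l Npos[OF u] by (simp add: diff_divide_distrib)
      ultimately have "1 / l - (a \<bullet> a - l\<^sup>2) / N u / l = - ((2 * p u - 2 * l) / N u)"
        using l by (simp add: diff_divide_distrib)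
      then have k: "(1 / l - (a \<bullet> a - l\<^sup>2) / N u / l) *\<^sub>R a = - ((2 * p u - 2 * l) / N u) *\<^sub>R a"
        by simp
      have "sphere_inversion e u = ((a \<bullet> a - l\<^sup>2) / N u) *\<^sub>R u + (1 / l - (a \<bullet> a - l\<^sup>2) / N u / l) *\<^sub>R a"
        unfolding sphere_inversion_def c unfolding e_def
        by (simp add: scaleR_diff_right scaleR_diff_left divide_inverse)
      also have "\<dots> = - (lift_vec l a 1 u /\<^sub>R N u)"
        unfolding k lift
        by (simp add: scaleR_add_right scaleR_diff_left divide_inverse algebra_simps)
      finally show ?thesis unfolding t[OF u] by simp
    qed
    then have "restrict (transport_dir P Q l) unit_sphere = restrict (\<lambda>x. - sphere_inversion e x) unit_sphere"
      by (intro restrict_ext) simp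
    then show ?thesis
      using moebius_comp[OF moebius_antipodal moebius_inversion[OF \<open>norm e > 1\<close>]] by simp
  next
    case 3
    define E where "E = a \<bullet> a"
    have E: "E > 0" using 3 by (simp add: E_def)
    define b where "b = (l / E) *\<^sub>R a"
    have "norm b > 1"
    proof -
      have "E = norm a * norm a" by (simp add: E_def power2_norm_eq_inner flip: power2_eq_square)
      then show ?thesis using 3 l by (simp add: b_def field_simps)
    qed
    have "transport_dir P Q l u =
      sphere_inversion b u - (2 * (sphere_inversion b u \<bullet> a) / (a \<bullet> a)) *\<^sub>R a"
      if u: "u \<in> unit_sphere" for u
    proof -
      have uu: "u \<bullet> u = 1" using u by (simp add: norm_eq_1)
      have ba: "b \<bullet> a = l" using E by (simp add: b_def flip: E_def)
      have b2: "(norm b)\<^sup>2 = l\<^sup>2 / E"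
        using E unfolding power2_norm_eq_inner by (simp add: b_def power2_eq_square flip: E_def)
      have bu: "u \<bullet> b = l * p u / E" by (simp add: b_def p_def inner_commute)
      have "(norm (u - b))\<^sup>2 = 1 - 2 * (u \<bullet> b) + (norm b)\<^sup>2"
        unfolding power2_norm_eq_inner by (simp add: inner_diff_left inner_diff_right uu inner_commute)
      also have "\<dots> = N u / E"
        unfolding b2 bu N using E by (simp add: field_simps flip: E_def)
      finally have ub: "(norm (u - b))\<^sup>2 = N u / E" .
      have c: "((norm b)\<^sup>2 - 1) / (norm (u - b))\<^sup>2 = (l\<^sup>2 - E) / N u"
        unfolding b2 ub using E Npos[OF u] by (simp add: field_simps)
      define c where "c = (l\<^sup>2 - E) / N u"
      have cN: "c * N u = l\<^sup>2 - E" using Npos[OF u] by (simp add: c_def)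
      have inv: "sphere_inversion b u = c *\<^sub>R u + (1 - c) *\<^sub>R b"
        unfolding sphere_inversion_def c c_def[symmetric]
        by (simp add: scaleR_diff_right scaleR_diff_left)
      have inva: "sphere_inversion b u \<bullet> a = c * p u + (1 - c) * l"
        unfolding inv inner_add_left inner_scaleR_left ba by (simp add: p_def inner_commute)
      have "((1 - c) * l - 2 * (c * p u + (1 - c) * l)) * N u = (2 * p u - 2 * l) * E"
        using cN N[of u] unfolding E_def[symmetric] by algebra
      then have "((1 - c) * l - 2 * (c * p u + (1 - c) * l)) / E = (2 * p u - 2 * l) / N u"
        using E Npos[OF u] by (simp add: frac_eq_eq)
      then have k: "(1 - c) * (l / E) - 2 * (c * p u + (1 - c) * l) / E = (2 * p u - 2 * l) / N u"
        by (simp only: diff_divide_distrib times_divide_eq_right)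
      have "sphere_inversion b u - (2 * (sphere_inversion b u \<bullet> a) / (a \<bullet> a)) *\<^sub>R a
        = c *\<^sub>R u + ((1 - c) * (l / E) - 2 * (c * p u + (1 - c) * l) / E) *\<^sub>R a"
        unfolding inva E_def[symmetric] unfolding inv unfolding b_def by (simp add: scaleR_diff_left)
      also have "\<dots> = lift_vec l a 1 u /\<^sub>R N u"
        unfolding k unfolding lift c_def E_def
        by (simp add: scaleR_add_right divide_inverse mult.commute)
      finally show ?thesis unfolding t[OF u] ..
    qed
    then have "restrict (transport_dir P Q l) unit_sphere =
      restrict (\<lambda>x. sphere_inversion b x - (2 * (sphere_inversion b x \<bullet> a) / (a \<bullet> a)) *\<^sub>R a) unit_sphere"
      by (intro restrict_ext) simp
    then show ?thesis
      using moebius_comp[OF moebius_reflection[OF 3(1)] moebius_inversion[OF \<open>norm b > 1\<close>]] by simp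
  qed
qed

section \<open>Recutting a closed polygon\<close>

lemma closed_polygon_cong:
  assumes "closed_polygon k V" "[i = j] (mod int k)"
  shows "V i = V j"
proof -
  have up: "V (x + int k * int n) = V x" for x n
  proof (induction n)
    case (Suc n)
    have "x + int k * int (Suc n) = (x + int k * int n) + int k" by (simp add: algebra_simps)
    then show ?case using assms(1) Suc by (simp only: closed_polygon_def)
  qed simp
  obtain m where m: "j = i + int k * m" using assms(2) by (auto simp: cong_iff_lin)
  show ?thesis
  proof (cases "m \<ge> 0")
    case True
    then show ?thesis using up[of i "nat m"] m by simp
  next
    case False
    then show ?thesis using up[of j "nat (- m)"] m by simp
  qed
qed

lemma not_cong_step:
  assumes "k \<ge> 2" "[j = i] (mod int k)"
  shows "\<not> [j - 1 = i] (mod int k)" "\<not> [j + 1 = i] (mod int k)"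
proof -
  have k: "\<not> int k dvd 1" using assms(1) by (simp add: zdvd1_eq)
  show "\<not> [j - 1 = i] (mod int k)"
  proof
    assume "[j - 1 = i] (mod int k)"
    from cong_diff[OF assms(2) this] show False using k by (simp add: cong_0_iff)
  qed
  show "\<not> [j + 1 = i] (mod int k)"
  proof
    assume "[j + 1 = i] (mod int k)"
    from cong_diff[OF this assms(2)] show False using k by (simp add: cong_0_iff)
  qed
qed

lemma recut_vertex:
  assumes "[j = i] (mod int k)" "V (j - 1) \<noteq> V (j + 1)"
  shows "recut k i V j = V j - recut_shift (V j - V (j - 1)) (V (j + 1) - V j)"
proof -
  define a b where "a = V j - V (j - 1)" and "b = V (j + 1) - V j"
  have d: "V (j + 1) - V (j - 1) = a + b" by (simp add: a_def b_def)
  have m: "2 *\<^sub>R (V j - midpoint (V (j - 1)) (V (j + 1))) = a - b"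
    by (simp add: midpoint_def a_def b_def algebra_simps scaleR_2)
  have "2 * ((V j - midpoint (V (j - 1)) (V (j + 1))) \<bullet> (a + b)) = a \<bullet> a - b \<bullet> b"
    using arg_cong[OF m, of "\<lambda>x. x \<bullet> (a + b)"]
    by (simp only: inner_scaleR_left) (simp add: inner_diff_left inner_diff_right inner_add_right inner_commute)
  then show ?thesis
    using assms(1) unfolding recut_def a_def[symmetric] b_def[symmetric]
    by (simp add: reflection_in_perp_bisector[OF assms(2)] d recut_shift_def power2_norm_eq_inner)
qed

lemma recut_fixed: "\<not> [j = i] (mod int k) \<Longrightarrow> recut k i V j = V j"
  by (simp add: recut_def)

lemma closed_polygon_recut:
  assumes "closed_polygon k V"
  shows "closed_polygon k (recut k i V)"
proof -
  have "[j + int k = i] (mod int k) \<longleftrightarrow> [j = i] (mod int k)" for j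
    by (simp add: cong_def)
  moreover have "V (j + int k) = V j" "V (j + int k - 1) = V (j - 1)" "V (j + int k + 1) = V (j + 1)" for j
    by (rule closed_polygon_cong[OF assms], simp add: cong_iff_dvd_diff; fail)+
  ultimately show ?thesis
    by (simp add: closed_polygon_def recut_def)
qed

text \<open>The diagonal at \<open>i\<close> is nondegenerate, hence so are the diagonals at all vertices congruent to it.\<close>

lemma recut_diagonal:
  assumes "closed_polygon k V" "V (i - 1) \<noteq> V (i + 1)" "[j = i] (mod int k)"
  shows "V (j - 1) \<noteq> V (j + 1)"
  using assms closed_polygon_cong[OF assms(1), of "j - 1" "i - 1"]
    closed_polygon_cong[OF assms(1), of "j + 1" "i + 1"]
  by (simp add: cong_add cong_diff)

text \<open>The two recut edges have the old lengths in exchanged order.\<close>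

lemma recut_edges:
  assumes "closed_polygon k V" "k \<ge> 2" "V (i - 1) \<noteq> V (i + 1)" "[j = i] (mod int k)"
  defines "a \<equiv> V j - V (j - 1)" and "b \<equiv> V (j + 1) - V j"
  shows "a + b \<noteq> 0" "recut k i V (j - 1) = V (j - 1)" "recut k i V (j + 1) = V (j + 1)"
    "recut k i V j - V (j - 1) = a - recut_shift a b"
    "V (j + 1) - recut k i V j = b + recut_shift a b"
    "dist (V (j - 1)) (recut k i V j) = dist (V j) (V (j + 1))"
    "dist (recut k i V j) (V (j + 1)) = dist (V (j - 1)) (V j)"
proof -
  note ne = recut_diagonal[OF assms(1,3,4)]
  show ab: "a + b \<noteq> 0" using ne by (simp add: a_def b_def)
  show "recut k i V (j - 1) = V (j - 1)" "recut k i V (j + 1) = V (j + 1)"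
    using not_cong_step[OF assms(2,4)] by (simp_all add: recut_fixed)
  note v = recut_vertex[of j i k V, OF assms(4) ne, folded a_def b_def]
  show a': "recut k i V j - V (j - 1) = a - recut_shift a b" unfolding v by (simp add: a_def)
  show b': "V (j + 1) - recut k i V j = b + recut_shift a b" unfolding v by (simp add: b_def)
  show "dist (V (j - 1)) (recut k i V j) = dist (V j) (V (j + 1))"
    using arg_cong[OF lift_recut(1)[OF ab], of sqrt]
    unfolding a'[symmetric] norm_eq_sqrt_inner[symmetric] unfolding b_def
    by (simp add: dist_norm norm_minus_commute)
  show "dist (recut k i V j) (V (j + 1)) = dist (V (j - 1)) (V j)"
    using arg_cong[OF lift_recut(2)[OF ab], of sqrt]
    unfolding b'[symmetric] norm_eq_sqrt_inner[symmetric] unfolding a_def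
    by (simp add: dist_norm norm_minus_commute)
qed

section \<open>Invariance of the monodromy\<close>

lemma transport_recut:
  assumes "closed_polygon k V" "k \<ge> 2" "V (i - 1) \<noteq> V (i + 1)" "[j = i] (mod int k)"
    and l: "l > 0" "\<And>m. l \<noteq> dist (V m) (V (m + 1))" and "norm u = 1"
  shows "transport_dir (recut k i V j) (V (j + 1)) l (transport_dir (V (j - 1)) (recut k i V j) l u)
       = transport_dir (V j) (V (j + 1)) l (transport_dir (V (j - 1)) (V j) l u)"
proof -
  note e = recut_edges[OF assms(1-4)]
  have s: "l \<noteq> dist (V (j - 1)) (V j)" "l \<noteq> dist (V j) (V (j + 1))"
    using l(2)[of "j - 1"] l(2)[of j] by simp_all
  have s': "l \<noteq> dist (V (j - 1)) (recut k i V j)" "l \<noteq> dist (recut k i V j) (V (j + 1))"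
    unfolding e using s by simp_all
  show ?thesis
    unfolding transport_dir_twice_eq_lift[OF l(1) \<open>norm u = 1\<close> s]
      transport_dir_twice_eq_lift[OF l(1) \<open>norm u = 1\<close> s'] e(4,5)
      lift_recut(3,4)[OF e(1)] ..
qed

lemma sides_recut:
  assumes "closed_polygon k V" "k \<ge> 2" "V (i - 1) \<noteq> V (i + 1)"
    and l: "\<And>m. l \<noteq> dist (V m) (V (m + 1))"
  shows "l \<noteq> dist (recut k i V m) (recut k i V (m + 1))"
proof -
  consider "[m = i] (mod int k)" | "[m + 1 = i] (mod int k)"
    | "\<not> [m = i] (mod int k)" "\<not> [m + 1 = i] (mod int k)" by blast
  then show ?thesis
  proof cases
    case 1
    show ?thesis using recut_edges(3,7)[OF assms(1-3) 1] l[of "m - 1"] by simp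
  next
    case 2
    show ?thesis using recut_edges(2,6)[OF assms(1-3) 2] l[of "m + 1"] by simp
  next
    case 3
    then show ?thesis using l[of m] by (simp add: recut_fixed)
  qed
qed

lemma norm_transport_along:
  assumes "l > 0" "\<And>m. l \<noteq> dist (V m) (V (m + 1))" "norm u = 1"
  shows "norm (transport_along V l j m u) = 1"
  using assms by (induction m) (auto intro!: norm_transport_dir)

text \<open>A path that starts and ends outside the class of \<open>i\<close> passes each recut vertex completely, so
  the steps can be compared one by one away from these vertices and in pairs around them.\<close>

lemma transport_along_recut:
  assumes "closed_polygon k V" "k \<ge> 2" "V (i - 1) \<noteq> V (i + 1)"
    and l: "l > 0" "\<And>m. l \<noteq> dist (V m) (V (m + 1))" and u: "norm u = 1"
    and j: "\<not> [j = i] (mod int k)"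
  shows "\<not> [j + int m = i] (mod int k) \<Longrightarrow>
    transport_along (recut k i V) l j m u = transport_along V l j m u"
proof (induction m rule: less_induct)
  case (less m)
  show ?case
  proof (cases m)
    case 0
    then show ?thesis by simp
  next
    case (Suc n)
    have jm: "j + int n + 1 = j + int m" by (simp add: Suc)
    show ?thesis
    proof (cases "[j + int n = i] (mod int k)")
      case False
      have "recut k i V (j + int n) = V (j + int n)" "recut k i V (j + int n + 1) = V (j + int n + 1)"
        using False less.prems unfolding jm by (simp_all add: recut_fixed)
      then show ?thesis using less.IH[of n] False Suc by simp
    next
      case True
      then obtain r where r: "n = Suc r" using j by (cases n) auto
      have c: "j + int n - 1 = j + int r" by (simp add: r)
      have "\<not> [j + int r = i] (mod int k)"
        using not_cong_step(1)[OF assms(2) True] unfolding c .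
      then have "transport_along (recut k i V) l j r u = transport_along V l j r u"
        using less.IH[of r] Suc r by simp
      moreover note transport_recut[OF assms(1-3) True l norm_transport_along[where V = V, OF l u, where j = j and m = r]]
        recut_edges(2,3)[OF assms(1-3) True]
      ultimately show ?thesis unfolding Suc c by (simp add: r ac_simps)
    qed
  qed
qed

lemma monodromy_recut:
  assumes "closed_polygon k V" "k \<ge> 2" "V (i - 1) \<noteq> V (i + 1)"
    and l: "l > 0" "\<And>m. l \<noteq> dist (V m) (V (m + 1))" 
    and j: "\<not> [j = i] (mod int k)"
  shows "monodromy k (recut k i V) l j = monodromy k V l j"
proof -
  have "\<not> [j + int k = i] (mod int k)" using j by (simp add: cong_def)
  then show ?thesis
    unfolding monodromy_def using transport_along_recut[OF assms(1-3) l _ j]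
    by (intro restrict_ext) simp
qed

lemma transport_along_moebius:
  assumes l: "l > 0" "\<And>m. l \<noteq> dist (V m) (V (m + 1))"
  shows "restrict (transport_along V l j m) unit_sphere \<in> carrier moebius_group"
proof (induction m)
  case 0
  have "transport_along V l j 0 = (\<lambda>u. u)" by auto
  then show ?case using moebius_id by metis
next
  case (Suc m)
  have "transport_along V l j (Suc m) =
    (\<lambda>u. transport_dir (V (j + int m)) (V (j + int m + 1)) l (transport_along V l j m u))"
    by auto
  then show ?case by (simp only: moebius_comp[OF transport_dir_moebius[OF l] Suc])
qed

lemma transport_along_Suc_first:
  "transport_along V l j (Suc m) u =
     transport_along V l (j + 1) m (transport_dir (V j) (V (j + 1)) l u)"
  by (induction m) (simp_all add: algebra_simps)

text \<open>Moving the base point by one edge conjugates the monodromy by the transport along this edge,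
  since the last edge of the new circuit is, by periodicity, the first edge of the old one.\<close>

lemma conjugacy_invariant_monodromy_Suc:
  assumes V: "closed_polygon k V"
    and l: "l > 0" "\<And>m. l \<noteq> dist (V m) (V (m + 1))"
    and F: "conjugacy_invariant F"
  shows "F (monodromy k V l (j + 1)) = F (monodromy k V l j)"
proof -
  interpret group moebius_group by (rule group_moebius_group)
  define T where "T = restrict (transport_dir (V j) (V (j + 1)) l) unit_sphere"
  have T: "T \<in> carrier moebius_group"
    unfolding T_def by (rule transport_dir_moebius[OF l])
  have M: "monodromy k V l i \<in> carrier moebius_group" for i
    unfolding monodromy_def by (rule transport_along_moebius[where V = V, OF l])
  have per: "V (j + int k) = V j" "V (j + int k + 1) = V (j + 1)"
    by (rule closed_polygon_cong[OF V], simp add: cong_iff_dvd_diff; fail)+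
  have "monodromy k V l (j + 1) \<otimes>\<^bsub>moebius_group\<^esub> T = T \<otimes>\<^bsub>moebius_group\<^esub> monodromy k V l j"
    unfolding moebius_mult[OF M T] moebius_mult[OF T M]
  proof (rule restrict_ext)
    fix u :: 'a assume u: "u \<in> unit_sphere"
    have "monodromy k V l (j + 1) (T u) = transport_along V l j (Suc k) u"
      unfolding transport_along_Suc_first using u moebius_maps_sphere[OF T u]
      by (simp add: T_def monodromy_def)
    also have "\<dots> = T (monodromy k V l j u)"
      using u moebius_maps_sphere[OF M u] by (simp add: T_def monodromy_def per)
    finally show "monodromy k V l (j + 1) (T u) = T (monodromy k V l j u)" .
  qed
  then have "monodromy k V l (j + 1) = T \<otimes>\<^bsub>moebius_group\<^esub> monodromy k V l j \<otimes>\<^bsub>moebius_group\<^esub> inv\<^bsub>moebius_group\<^esub> T"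
    using T M by (metis inv_solve_right m_closed)
  then show ?thesis using F T M unfolding conjugacy_invariant_def by metis
qed

section \<open>Recutting and the bicycle correspondence\<close>

text \<open>The bivector of \<open>x\<close> and \<open>y\<close>, encoded as a skew endomorphism; this gives the exterior product
  of two vectors in any dimension.\<close>

definition wedge :: "'a::real_inner \<Rightarrow> 'a \<Rightarrow> 'a \<Rightarrow> 'a" where
  "wedge x y z = (y \<bullet> z) *\<^sub>R x - (x \<bullet> z) *\<^sub>R y"

lemma wedge_simps:
  "wedge (x + x') y z = wedge x y z + wedge x' y z"
  "wedge (x - x') y z = wedge x y z - wedge x' y z"
  "wedge (c *\<^sub>R x) y z = c *\<^sub>R wedge x y z"
  "wedge x (y + y') z = wedge x y z + wedge x y' z"
  "wedge x (y - y') z = wedge x y z - wedge x y' z"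
  "wedge x (c *\<^sub>R y) z = c *\<^sub>R wedge x y z"
  "wedge x x z = 0"
  by (simp_all add: wedge_def inner_add_left inner_diff_left algebra_simps)

lemma wedge_swap: "wedge y x z = - wedge x y z"
  by (simp add: wedge_def)

text \<open>Exterior and inner product with \<open>d\<close> give the components orthogonal and parallel to \<open>d\<close>.\<close>

lemma wedge_determines:
  assumes "\<And>z. wedge x d z = wedge y d z" "x \<bullet> d = y \<bullet> d" "d \<noteq> 0"
  shows "x = y"
  using assms(1)[of d] assms(2,3) by (simp add: wedge_def)

lemma wedge_recut:
  "wedge (a - recut_shift a b) (b + recut_shift a b) z = wedge a b z"
proof -
  obtain t where "recut_shift a b = t *\<^sub>R (a + b)" by (auto simp: recut_shift_def)
  then show ?thesis
    by (simp add: wedge_simps wedge_swap[of b a] algebra_simps)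
qed

text \<open>Both sides are multiples of \<open>wedge (Q - P) u\<close>: the sum \<open>u + v\<close> is a multiple of the axis
  \<open>(Q - P) - l u\<close>.\<close>

lemma transport_dir_wedge:
  assumes "l > 0" "norm u = 1" "l \<noteq> dist P Q"
  defines "v \<equiv> transport_dir P Q l u"
  shows "l *\<^sub>R wedge u v z = wedge (Q - P) (u + v) z"
proof -
  define x where "x = (Q - P) - l *\<^sub>R u"
  obtain c where c: "v = c *\<^sub>R x - u"
    using transport_dir_formula[OF assms(1-3)] unfolding v_def x_def by blast
  have Q: "Q - P = x + l *\<^sub>R u" by (simp add: x_def)
  show ?thesis
    unfolding c Q by (simp add: wedge_simps)
qed

text \<open>The side \<open>XY\<close> of the isosceles trapezoid formed by \<open>P\<close>, \<open>Q\<close> and the transported points.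
  The vector from \<open>X\<close> to \<open>Y\<close> is \<open>\<xi> + l v\<close> while \<open>Q - P = \<xi> + l u\<close>, and \<open>u\<close>, \<open>v\<close> are mirror images in the
  line spanned by \<open>\<xi> = (Q - P) - l u\<close>.\<close>

lemma norm_transport_edge:
  assumes "l > 0" "norm u = 1" "l \<noteq> dist P Q"
  shows "norm ((Q - P) + l *\<^sub>R (transport_dir P Q l u - u)) = norm (Q - P)"
proof -
  define x where "x = (Q - P) - l *\<^sub>R u"
  define v where "v = transport_dir P Q l u"
  have "norm (Q - P) \<noteq> l" using assms by (simp add: dist_norm norm_minus_commute)
  then have x: "x \<bullet> x \<noteq> 0"
    using transport_axis(1)[OF assms(2,1)] by (simp add: x_def)
  have v: "v = (2 * (u \<bullet> x) / (x \<bullet> x)) *\<^sub>R x - u"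
    using transport_dir_formula[OF assms] by (simp add: v_def x_def power2_norm_eq_inner)
  have vx: "v \<bullet> x = u \<bullet> x" using x by (simp add: v inner_diff_left)
  have "v \<bullet> v = u \<bullet> u"
    using norm_transport_dir[OF assms] assms(2) by (simp add: v_def norm_eq_1)
  then have "(x + l *\<^sub>R v) \<bullet> (x + l *\<^sub>R v) = (x + l *\<^sub>R u) \<bullet> (x + l *\<^sub>R u)"
    using vx by (simp add: inner_add_left inner_add_right inner_commute)
  moreover have "(Q - P) + l *\<^sub>R (v - u) = x + l *\<^sub>R v" "Q - P = x + l *\<^sub>R u"
    by (simp_all add: x_def scaleR_diff_right)
  ultimately have "norm ((Q - P) + l *\<^sub>R (v - u)) = norm (Q - P)" by (simp only: norm_eq)
  then show ?thesis by (simp add: v_def)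
qed

text \<open>The point of this formula is what its right-hand side leaves out: the bivector of two
  consecutive edges of the transported path depends on \<open>a\<close> and \<open>b\<close> only through \<open>a + b\<close> and their
  bivector, and on the directions only through the first one, \<open>u\<close>, and the last one, \<open>w\<close>.\<close>

lemma wedge_transported_edges:
  assumes l: "l > 0" "norm u = 1" "l \<noteq> dist P Q" "l \<noteq> dist Q R"
  defines "v \<equiv> transport_dir P Q l u"
  defines "w \<equiv> transport_dir Q R l v"
  defines "a \<equiv> Q - P" and "b \<equiv> R - Q"
  shows "wedge (a + l *\<^sub>R (v - u)) (b + l *\<^sub>R (w - v)) z =
    wedge a b z + l *\<^sub>R wedge (a + b) (u + w) z - l\<^sup>2 *\<^sub>R wedge u w z"
proof -
  have uv: "l *\<^sub>R wedge u v z = wedge a u z + wedge a v z"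
    using transport_dir_wedge[OF l(1-3), of z] by (simp add: v_def a_def wedge_simps)
  have "norm v = 1" unfolding v_def by (rule norm_transport_dir[OF l(1-3)])
  from transport_dir_wedge[OF l(1) this l(4), of z]
  have vw: "l *\<^sub>R wedge v w z = wedge b v z + wedge b w z" by (simp add: w_def b_def wedge_simps)
  have "wedge (a + l *\<^sub>R (v - u)) (b + l *\<^sub>R (w - v)) z =
    wedge a b z + l *\<^sub>R (wedge a w z - wedge a v z - wedge b v z + wedge b u z
      + l *\<^sub>R wedge v w z - l *\<^sub>R wedge u w z + l *\<^sub>R wedge u v z)"
    by (simp add: wedge_simps wedge_swap[of v b] wedge_swap[of u b] algebra_simps)
  also have "\<dots> = wedge a b z + l *\<^sub>R wedge (a + b) (u + w) z - l\<^sup>2 *\<^sub>R wedge u w z"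
    unfolding uv vw by (simp add: wedge_simps algebra_simps power2_eq_square)
  finally show ?thesis .
qed

text \<open>Transporting along the recut path of \<open>V\<close> gives the same end point \<open>W (j + 1)\<close> and some middle
  point; it has to be the recut vertex of \<open>W\<close>. Let \<open>h\<close> be the edge from \<open>W (j - 1)\<close> to this middle point,
  \<open>r\<close> the recut edge of \<open>W\<close>, and \<open>d\<close> the diagonal \<open>W (j + 1) - W (j - 1)\<close>. The edge lengths give
  \<open>h \<bullet> d = r \<bullet> d\<close>, but in dimension at least three this leaves a sphere of possible \<open>h\<close>. The bivector
  of \<open>h\<close> and \<open>d\<close> removes the remaining freedom: it is the bivector of the two edges, which neither
  recutting nor the passage to the transported path of the recut polygon changes.\<close>

lemma transport_of_recut_vertex:
  fixes V W :: "int \<Rightarrow> 'a::euclidean_space"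
  assumes V: "closed_polygon k V" and W: "closed_polygon k W" and k: "k \<ge> 2"
    and ne: "V (i - 1) \<noteq> V (i + 1)" "W (i - 1) \<noteq> W (i + 1)" and j: "[j = i] (mod int k)"
    and l: "l > 0" "\<And>m. l \<noteq> dist (V m) (V (m + 1))" and u: "norm u = 1"
  defines "v \<equiv> transport_dir (V (j - 1)) (V j) l u"
  defines "w \<equiv> transport_dir (V j) (V (j + 1)) l v"
  defines "v' \<equiv> transport_dir (V (j - 1)) (recut k i V j) l u"
  assumes Weq: "W (j - 1) = V (j - 1) + l *\<^sub>R u" "W j = V j + l *\<^sub>R v" "W (j + 1) = V (j + 1) + l *\<^sub>R w"
  shows "recut k i W j = recut k i V j + l *\<^sub>R v'"
proof -
  note eV = recut_edges[OF V k ne(1) j] and eW = recut_edges[OF W k ne(2) j]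
  define V' where "V' = recut k i V j"
  define W' where "W' = recut k i W j"
  define h where "h = V' + l *\<^sub>R v' - W (j - 1)"
  define f g where "f = W j - W (j - 1)" and "g = W (j + 1) - W j"
  define h' where "h' = W (j + 1) - (V' + l *\<^sub>R v')"
  have s: "l \<noteq> dist (V (j - 1)) (V j)" "l \<noteq> dist (V j) (V (j + 1))"
    using l(2)[of "j - 1"] l(2)[of j] by simp_all
  have s': "l \<noteq> dist (V (j - 1)) V'" "l \<noteq> dist V' (V (j + 1))"
    unfolding V'_def eV using s by simp_all
  have w: "transport_dir V' (V (j + 1)) l v' = w"
    using transport_recut[OF V k ne(1) j l u] by (simp add: V'_def v'_def w_def v_def)
  have nv: "norm v = 1" unfolding v_def by (rule norm_transport_dir[OF l(1) u s(1)])
  have nv': "norm v' = 1" unfolding v'_def V'_def[symmetric] by (rule norm_transport_dir[OF l(1) u s'(1)])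
  have f: "f = V j - V (j - 1) + l *\<^sub>R (v - u)" and g: "g = V (j + 1) - V j + l *\<^sub>R (w - v)"
    and h: "h = V' - V (j - 1) + l *\<^sub>R (v' - u)" and h': "h' = V (j + 1) - V' + l *\<^sub>R (w - v')"
    unfolding f_def g_def h_def h'_def Weq by (simp_all add: algebra_simps)
  have D: "f + g \<noteq> 0" using eW(1) by (simp add: f_def g_def)
  have hh: "h + h' = f + g" by (simp add: f_def g_def h_def h'_def)
  have wedge: "wedge h h' z = wedge f g z" for z
  proof -
    have "wedge (V' - V (j - 1)) (V (j + 1) - V') z = wedge (V j - V (j - 1)) (V (j + 1) - V j) z"
      unfolding V'_def eV(4,5) by (rule wedge_recut)
    then show ?thesis
      using wedge_transported_edges[OF l(1) u s, of z, folded v_def, folded w_def]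
        wedge_transported_edges[OF l(1) u s', of z, folded V'_def, unfolded v'_def[folded V'_def, symmetric] w]
      unfolding f g h h' by simp
  qed
  have nf: "norm f = norm (V j - V (j - 1))"
    unfolding f v_def by (rule norm_transport_edge[OF l(1) u s(1)])
  have ng: "norm g = norm (V (j + 1) - V j)"
    unfolding g w_def by (rule norm_transport_edge[OF l(1) nv s(2)])
  have "norm h = norm (V' - V (j - 1))"
    unfolding h v'_def V'_def[symmetric] by (rule norm_transport_edge[OF l(1) u s'(1)])
  also have "\<dots> = norm g"
    using eV(6) by (simp add: ng V'_def dist_norm norm_minus_commute)
  finally have nh: "h \<bullet> h = g \<bullet> g" by (simp add: norm_eq)
  have "norm h' = norm (V (j + 1) - V')"
    unfolding h' w[symmetric] by (rule norm_transport_edge[OF l(1) nv' s'(2)])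
  also have "\<dots> = norm f"
    using eV(7) by (simp add: nf V'_def dist_norm norm_minus_commute)
  finally have nh': "h' \<bullet> h' = f \<bullet> f" by (simp add: norm_eq)
  define r where "r = W' - W (j - 1)"
  have r: "r = f - recut_shift f g" "W (j + 1) - W' = g + recut_shift f g"
    unfolding r_def W'_def f_def g_def by (rule eW(4,5))+
  have "h = r"
  proof (rule wedge_determines[OF _ _ D])
    fix z
    have "wedge h (f + g) z = wedge f g z"
      using wedge[of z] by (simp add: wedge_simps flip: hh)
    moreover have "wedge r (f + g) z = wedge r (r + (g + recut_shift f g)) z"
      by (simp add: r(1))
    moreover have "\<dots> = wedge r (g + recut_shift f g) z"
      by (simp only: wedge_simps add_0)
    moreover have "\<dots> = wedge f g z"
      unfolding r(1) by (rule wedge_recut)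
    ultimately show "wedge h (f + g) z = wedge r (f + g) z" by simp
  next
    \<comment> \<open>The law of cosines: the two edge lengths of a path determine the component of its first
      edge along the diagonal.\<close>
    have two: "2 * (x \<bullet> (f + g)) = x \<bullet> x + (f + g) \<bullet> (f + g) - y \<bullet> y" if "x + y = f + g" for x y
      unfolding that[symmetric] by (simp add: inner_add_left inner_add_right inner_commute)
    have "2 * (h \<bullet> (f + g)) = 2 * (r \<bullet> (f + g))"
      using two[OF hh] two[of r "g + recut_shift f g"] lift_recut(1,2)[OF D]
      by (simp add: r nh nh')
    then show "h \<bullet> (f + g) = r \<bullet> (f + g)" by simp
  qed
  then show ?thesis by (simp add: h_def r_def V'_def W'_def)
qed

lemma transport_eq_transport_dir:
  assumes "l > 0"
  shows "transport P Q (P + l *\<^sub>R u) = Q + l *\<^sub>R transport_dir P Q l u"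
  using assms by (simp add: transport_dir_def)

lemma bicycle_corr_recut:
  fixes V W :: "int \<Rightarrow> 'a::euclidean_space"
  assumes V: "closed_polygon k V" and W: "closed_polygon k W" and k: "k \<ge> 2"
    and ne: "V (i - 1) \<noteq> V (i + 1)" "W (i - 1) \<noteq> W (i + 1)"
    and l: "l > 0" "\<And>m. l \<noteq> dist (V m) (V (m + 1))"
    and VW: "bicycle_corr l V W"
  shows "bicycle_corr l (recut k i V) (recut k i W)"
proof -
  define u where "u m = (W m - V m) /\<^sub>R l" for m
  have Wu: "W m = V m + l *\<^sub>R u m" for m using l(1) by (simp add: u_def)
  have nu: "norm (u m) = 1" for m
    using VW l(1) by (simp add: u_def bicycle_corr_def dist_norm norm_minus_commute)
  have u_Suc: "u (m + 1) = transport_dir (V m) (V (m + 1)) l (u m)" for m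
  proof -
    have "W (m + 1) = transport (V m) (V (m + 1)) (V m + l *\<^sub>R u m)"
      using VW Wu[of m] by (simp add: bicycle_corr_def)
    then show ?thesis
      unfolding transport_eq_transport_dir[OF l(1)] using l(1) Wu[of "m + 1"] by simp
  qed
  define V' where "V' = recut k i V"
  define W' where "W' = recut k i W"
  \<comment> \<open>Directions from \<open>V'\<close> to \<open>W'\<close>. At a recut vertex the direction is taken to be the transported
    one; that it really points to the recut vertex of \<open>W\<close> is
    the content of \<open>transport_of_recut_vertex\<close>.\<close>
  define u' where "u' m = (if [m = i] (mod int k)
    then transport_dir (V (m - 1)) (V' m) l (u (m - 1)) else u m)" for m
  have l': "l \<noteq> dist (V' m) (V' (m + 1))" for m
    unfolding V'_def by (rule sides_recut[OF V k ne(1) l(2)])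
  have nu': "norm (u' m) = 1" for m
  proof (cases "[m = i] (mod int k)")
    case True
    have "V' (m - 1) = V (m - 1)"
      using recut_edges(2)[OF V k ne(1) True] by (simp add: V'_def)
    then show ?thesis using norm_transport_dir[OF l(1) nu, of "V (m - 1)" "V' m"] l'[of "m - 1"] True
      by (simp add: u'_def)
  qed (simp add: u'_def nu)
  have W': "W' m = V' m + l *\<^sub>R u' m" for m
  proof (cases "[m = i] (mod int k)")
    case True
    have "u m = transport_dir (V (m - 1)) (V m) l (u (m - 1))" using u_Suc[of "m - 1"] by simp
    moreover note transport_of_recut_vertex[OF V W k ne True l nu[of "m - 1"]] Wu[of "m - 1"] Wu[of m]
      Wu[of "m + 1"] u_Suc[of m]
    ultimately show ?thesis using True by (simp add: W'_def V'_def u'_def)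
  qed (simp add: W'_def V'_def u'_def recut_fixed Wu)
  have "u' (m + 1) = transport_dir (V' m) (V' (m + 1)) l (u' m)" for m
  proof -
    consider "[m = i] (mod int k)" | "[m + 1 = i] (mod int k)"
      | "\<not> [m = i] (mod int k)" "\<not> [m + 1 = i] (mod int k)" by blast
    then show ?thesis
    proof cases
      case 1
      have "V' (m + 1) = V (m + 1)"
        using recut_edges(3)[OF V k ne(1) 1] by (simp add: V'_def)
      then show ?thesis
        using transport_recut[OF V k ne(1) 1 l nu[of "m - 1"]] u_Suc[of m] u_Suc[of "m - 1"]
          not_cong_step(2)[OF k 1] 1 by (simp add: V'_def u'_def)
    next
      case 2
      have "V' m = V m"
        using recut_edges(2)[OF V k ne(1) 2] by (simp add: V'_def)
      then show ?thesis using not_cong_step(1)[OF k 2] 2 by (simp add: u'_def)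
    next
      case 3
      then show ?thesis using u_Suc[of m] by (simp add: u'_def V'_def recut_fixed)
    qed
  qed
  then have "W' (m + 1) = transport (V' m) (V' (m + 1)) (W' m)" for m
    unfolding W' transport_eq_transport_dir[OF l(1)] by simp
  moreover have "dist (V' m) (W' m) = l" for m
    using l(1) nu'[of m] by (simp add: W' dist_norm)
  ultimately show ?thesis by (simp add: bicycle_corr_def V'_def W'_def)
qed

theorem theorem4:
  fixes V :: "int \<Rightarrow> 'a::euclidean_space" and k :: nat
  assumes "DIM('a) \<ge> 2" and "k \<ge> 3" and "closed_polygon k V"
  shows "(\<forall>(i::int) (l::real).
            V (i - 1) \<noteq> V (i + 1) \<and> l > 0 \<and> (\<forall>m. l \<noteq> dist (V m) (V (m + 1))) \<longrightarrow>
              (\<forall>j. \<not> [j = i] (mod int k) \<longrightarrow>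
                 monodromy k (recut k i V) l j = monodromy k V l j) \<and>
              (\<forall>F :: ('a \<Rightarrow> 'a) \<Rightarrow> 'b. conjugacy_invariant F \<longrightarrow>
                 F (monodromy k (recut k i V) l 1) = F (monodromy k V l 1)))
       \<and> (\<forall>(l::real) (W :: int \<Rightarrow> 'a).
            l > 0 \<and> (\<forall>m. l \<noteq> dist (V m) (V (m + 1))) \<and>
            closed_polygon k W \<and> bicycle_corr l V W \<longrightarrow>
              (\<forall>i. V (i - 1) \<noteq> V (i + 1) \<and> W (i - 1) \<noteq> W (i + 1) \<longrightarrow>
                 bicycle_corr l (recut k i V) (recut k i W)))"
proof (intro conjI allI impI)
  have k: "k \<ge> 2" using assms(2) by simp
  note V = assms(3)
  {
    fix i :: int and l :: real
    assume "V (i - 1) \<noteq> V (i + 1) \<and> l > 0 \<and> (\<forall>m. l \<noteq> dist (V m) (V (m + 1)))"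
    then have ne: "V (i - 1) \<noteq> V (i + 1)" and l: "l > 0" "\<And>m. l \<noteq> dist (V m) (V (m + 1))" by auto
    show M: "monodromy k (recut k i V) l j = monodromy k V l j" if "\<not> [j = i] (mod int k)" for j
      by (rule monodromy_recut[OF V k ne l that])
    fix F :: "('a \<Rightarrow> 'a) \<Rightarrow> 'b"
    assume F: "conjugacy_invariant F"
    show "F (monodromy k (recut k i V) l 1) = F (monodromy k V l 1)"
    \<comment> \<open>If the base vertex itself is recut, the base point is moved to the next vertex, where the
      monodromies coincide.\<close>
    proof (cases "[1 = i] (mod int k)")
      case True
      have "F (monodromy k (recut k i V) l 1) = F (monodromy k (recut k i V) l (1 + 1))"
        using conjugacy_invariant_monodromy_Suc[OF closed_polygon_recut[OF V] l(1)
            sides_recut[OF V k ne l(2)] F] by metis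
      also have "\<dots> = F (monodromy k V l (1 + 1))"
        using M[OF not_cong_step(2)[OF k True]] by simp
      also have "\<dots> = F (monodromy k V l 1)"
        by (rule conjugacy_invariant_monodromy_Suc[OF V l F])
      finally show ?thesis .
    next
      case False
      then show ?thesis using M by simp
    qed
  }
  fix l :: real and W :: "int \<Rightarrow> 'a" and i :: int
  assume "l > 0 \<and> (\<forall>m. l \<noteq> dist (V m) (V (m + 1))) \<and> closed_polygon k W \<and> bicycle_corr l V W"
    and "V (i - 1) \<noteq> V (i + 1) \<and> W (i - 1) \<noteq> W (i + 1)"
  then show "bicycle_corr l (recut k i V) (recut k i W)"
    using bicycle_corr_recut[OF V _ k] by blast
qed

end
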